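(* Let $\mathcal{T}$ be a self-affine tiling in $\mathbb{R}^d$ with expansion map $Q$, and let $w$ be the pseudo norm on $\mathbb{R}^d$ corresponding to $Q$. Then each tile $T=(A,i)$ of $\mathcal{T}$ satisfies $$\dim_H^w(\partial A)<d .$$
   Context: **Tilings.** Fix types (colours) $\{1,\dots,m\}$. A tile in $\mathbb{R}^d$ is a pair $T=(A,i)$, where $A=\mathrm{supp}(T)$ is a compact set equal to the closure of its interior and $i$ is its type; $g+T=(g+A,i)$ for $g\in\mathbb{R}^d$. A patch is a finite set of tiles with mutually disjoint interiors. A tiling of $\mathbb{R}^d$ is a set $\mathcal{T}$ of tiles whose supports cover $\mathbb{R}^d$, distinct tiles having disjoint interiors; any two tiles of $\mathcal{T}$ of the same type are translates of each other. $\mathcal{T}$ has finite local complexity (FLC) if for each $r>0$ there are, up to translation, only finitely many patches of $\mathcal{T}$ whose support lies in some ball of radius $r$. $\mathcal{T}$ is repetitive if for every compact $K\subset\mathbb{R}^d$ the set $\{t\in\mathbb{R}^d:\mathcal{T}\sqcap K=(t+\mathcal{T})\sqcap K\}$ is relatively dense, where $\mathcal{T}\sqcap K$ is the set of tiles whose supports meet $K$. **Self-affine tilings.** A linear map $Q:\mathbb{R}^d\to\mathbb{R}^d$ is expansive if all its eigenvalues lie outside the closed unit disk. A tile-substitution $\Omega$ with expansive map $Q$ on prototiles $T_i=(A_i,i)$, $i\le m$, is given by finite digit sets $\mathcal{D}_{ij}\subset\mathbb{R}^d$ (some possibly empty) via $\Omega(T_j)=\{u+T_i:u\in\mathcal{D}_{ij},\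 i\le m\}$, where $QA_j=\bigcup_{i=1}^m(\mathcal{D}_{ij}+A_i)$ and all sets on the right have disjoint interiors. It extends by $\Omega(x+T_j)=Qx+\Omega(T_j)$ and to sets of tiles by unions. It is primitive if the matrix $(\#\mathcal{D}_{ij})$ is primitive. A self-affine tiling is a repetitive tiling $\mathcal{T}$ with FLC and $\Omega(\mathcal{T})=\mathcal{T}$ for a primitive tile-substitution $\Omega$; its tiles are translates of the $T_i$. **Pseudo norm and modified Hausdorff dimension (He–Lau).** A pseudo norm corresponding to $Q$ is a continuous function $w:\mathbb{R}^d\to[0,\infty)$ with $w(x)=w(-x)$, $w(x)=0$ iff $x=0$, inducing the same topology as the Euclidean norm, such that $w(Qx)=|\det Q|^{1/d}w(x)$ for all $x$, and $w(x+y)\le c(w)\max(w(x),w(y))$ for all $x,y$ with some constant $c(w)>0$. For $U\subset\mathbb{R}^d$ open put $\mathrm{diam}_w(U)=\sup_{x,y\in U}w(x-y)$. For $X\subset\mathbb{R}^d$ and $s,\delta>0$ put $$\mathcal{H}^{s,\delta}_w(X)=\inf\Big\{\sum_i\mathrm{diam}_w(U_i)^s:\ X\subset\bigcup_iU_i,\ \mathrm{diam}_w(U_i)<\delta\Big\}$$ (countable covers by open sets), $\mathcal{H}^s_w(X)=\lim_{\delta\downarrow0}\mathcal{H}^{s,\delta}_w(X)$, and $\dim_H^w(X)=\inf\{s:\mathcal{H}^s_w(X)=0\}=\sup\{s:\mathcal{H}^s_w(X)=\infty\}$. *)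

theory Defs
  imports "HOL-Analysis.Analysis"
begin

section \<open>Tiles and tilings\<close>

text \<open>The colours are the elements of a finite type \<open>'m\<close> instead of \<open>{1,\<dots>,m}\<close>.\<close>

type_synonym ('d, 'm) tile = "(real ^ 'd) set \<times> 'm"

definition is_tile :: "('d::finite, 'm) tile \<Rightarrow> bool" where
  "is_tile T \<longleftrightarrow> compact (fst T) \<and> fst T = closure (interior (fst T))"

definition translate_tile :: "real ^ 'd \<Rightarrow> ('d::finite, 'm) tile \<Rightarrow> ('d, 'm) tile" where
  "translate_tile g T = ((+) g ` fst T, snd T)"

definition disjoint_interiors :: "('d::finite, 'm) tile set \<Rightarrow> bool" where
  "disjoint_interiors P \<longleftrightarrow>
     (\<forall>S\<in>P. \<forall>T\<in>P. S \<noteq> T \<longrightarrow> interior (fst S) \<inter> interior (fst T) = {})"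

definition patch :: "('d::finite, 'm) tile set \<Rightarrow> bool" where
  "patch P \<longleftrightarrow> finite P \<and> (\<forall>T\<in>P. is_tile T) \<and> disjoint_interiors P"

definition tiling :: "('d::finite, 'm) tile set \<Rightarrow> bool" where
  "tiling \<T> \<longleftrightarrow>
     (\<forall>T\<in>\<T>. is_tile T) \<and>
     (\<Union>T\<in>\<T>. fst T) = UNIV \<and>
     disjoint_interiors \<T> \<and>
     (\<forall>S\<in>\<T>. \<forall>T\<in>\<T>. snd S = snd T \<longrightarrow> (\<exists>g. T = translate_tile g S))"

definition finite_local_complexity :: "('d::finite, 'm) tile set \<Rightarrow> bool" where
  "finite_local_complexity \<T> \<longleftrightarrow>
     (\<forall>r>0. \<exists>F. finite F \<and>
        (\<forall>P x. patch P \<and> P \<subseteq> \<T> \<and> (\<Union>T\<in>P. fst T) \<subseteq> cball x r \<longrightarrow>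
           (\<exists>P'\<in>F. \<exists>g. P = translate_tile g ` P')))"

definition tiles_meeting :: "('d::finite, 'm) tile set \<Rightarrow> (real ^ 'd) set \<Rightarrow> ('d, 'm) tile set" where
  "tiles_meeting \<T> K = {T \<in> \<T>. fst T \<inter> K \<noteq> {}}"

definition relatively_dense :: "(real ^ 'd::finite) set \<Rightarrow> bool" where
  "relatively_dense S \<longleftrightarrow> (\<exists>R>0. \<forall>x. \<exists>t\<in>S. dist x t \<le> R)"

definition repetitive :: "('d::finite, 'm) tile set \<Rightarrow> bool" where
  "repetitive \<T> \<longleftrightarrow>
     (\<forall>K. compact K \<longrightarrow>
        relatively_dense {t. tiles_meeting \<T> K = tiles_meeting (translate_tile t ` \<T>) K})"

section \<open>Self-affine tilings\<close>

text \<open>Eigenvalues are complex, i.e. those of the complexified matrix of the map.\<close>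

definition complex_eigenvalue :: "(real ^ 'd \<Rightarrow> real ^ 'd::finite) \<Rightarrow> complex \<Rightarrow> bool" where
  "complex_eigenvalue Q c \<longleftrightarrow>
     (\<exists>v::complex ^ 'd. v \<noteq> 0 \<and> map_matrix complex_of_real (matrix Q) *v v = c *s v)"

definition expansive :: "(real ^ 'd \<Rightarrow> real ^ 'd::finite) \<Rightarrow> bool" where
  "expansive Q \<longleftrightarrow> linear Q \<and> (\<forall>c. complex_eigenvalue Q c \<longrightarrow> 1 < norm c)"

definition primitive_matrix :: "nat ^ 'm ^ 'm::finite \<Rightarrow> bool" where
  "primitive_matrix M \<longleftrightarrow> (\<exists>k\<ge>1. \<forall>i j. 0 < (((**) M ^^ k) (mat 1)) $ i $ j)"

text \<open>A tile-substitution with prototiles \<open>(A j, j)\<close> and digit sets \<open>D i j\<close>.\<close>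

definition tile_substitution ::
    "(real ^ 'd \<Rightarrow> real ^ 'd::finite) \<Rightarrow> ('m::finite \<Rightarrow> (real ^ 'd) set) \<Rightarrow>
     ('m \<Rightarrow> 'm \<Rightarrow> (real ^ 'd) set) \<Rightarrow> bool" where
  "tile_substitution Q A D \<longleftrightarrow>
     expansive Q \<and>
     (\<forall>j. is_tile (A j, j)) \<and>
     (\<forall>i j. finite (D i j)) \<and>
     (\<forall>j. Q ` A j = (\<Union>i. \<Union>u\<in>D i j. (+) u ` A i)) \<and>
     (\<forall>j i i'. \<forall>u\<in>D i j. \<forall>u'\<in>D i' j. (i, u) \<noteq> (i', u') \<longrightarrow>
        interior ((+) u ` A i) \<inter> interior ((+) u' ` A i') = {})"

definition substitute_prototile ::
    "('m::finite \<Rightarrow> (real ^ 'd::finite) set) \<Rightarrow> ('m \<Rightarrow> 'm \<Rightarrow> (real ^ 'd) set) \<Rightarrow>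
     'm \<Rightarrow> ('d, 'm) tile set" where
  "substitute_prototile A D j = {translate_tile u (A i, i) |u i. u \<in> D i j}"

text \<open>A nonempty compact set determines the vector by which it is translated, so \<open>x\<close> below is
  determined by the tile \<open>x + T\<^sub>j\<close>.\<close>

definition substitute ::
    "(real ^ 'd \<Rightarrow> real ^ 'd::finite) \<Rightarrow> ('m::finite \<Rightarrow> (real ^ 'd) set) \<Rightarrow>
     ('m \<Rightarrow> 'm \<Rightarrow> (real ^ 'd) set) \<Rightarrow> ('d, 'm) tile set \<Rightarrow> ('d, 'm) tile set" where
  "substitute Q A D S =
     \<Union>{translate_tile (Q x) ` substitute_prototile A D j |x j. translate_tile x (A j, j) \<in> S}"

definition self_affine_tiling ::
    "(real ^ 'd \<Rightarrow> real ^ 'd::finite) \<Rightarrow> ('d, 'm::finite) tile set \<Rightarrow> bool" where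
  "self_affine_tiling Q \<T> \<longleftrightarrow>
     tiling \<T> \<and> repetitive \<T> \<and> finite_local_complexity \<T> \<and>
     (\<exists>A D. tile_substitution Q A D \<and>
        primitive_matrix (\<chi> i j. card (D i j)) \<and>
        (\<forall>T\<in>\<T>. \<exists>x j. T = translate_tile x (A j, j)) \<and>
        substitute Q A D \<T> = \<T>)"

section \<open>Pseudo norms and the modified Hausdorff dimension\<close>

text \<open>The last conjunct says that the topology generated by the \<open>w\<close>-balls is the Euclidean one.\<close>

definition pseudo_norm :: "(real ^ 'd \<Rightarrow> real ^ 'd::finite) \<Rightarrow> (real ^ 'd \<Rightarrow> real) \<Rightarrow> bool" where
  "pseudo_norm Q w \<longleftrightarrow>
     continuous_on UNIV w \<and>
     (\<forall>x. 0 \<le> w x) \<and>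
     (\<forall>x. w x = w (- x)) \<and>
     (\<forall>x. w x = 0 \<longleftrightarrow> x = 0) \<and>
     (\<forall>x. w (Q x) = \<bar>det (matrix Q)\<bar> powr (1 / real CARD('d)) * w x) \<and>
     (\<exists>c>0. \<forall>x y. w (x + y) \<le> c * max (w x) (w y)) \<and>
     (\<forall>U. open U \<longleftrightarrow> (\<forall>x\<in>U. \<exists>r>0. \<forall>y. w (y - x) < r \<longrightarrow> y \<in> U))"

text \<open>The supremum is taken in \<open>[0,\<infinity>]\<close>; in particular the empty set has diameter \<open>0\<close>.\<close>

definition diam_w :: "(real ^ 'd::finite \<Rightarrow> real) \<Rightarrow> (real ^ 'd) set \<Rightarrow> ennreal" where
  "diam_w w U = (SUP x\<in>U. SUP y\<in>U. ennreal (w (x - y)))"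

text \<open>Countable covers are sequences, which may contain the empty set.  All diameters in a
  cover are below \<open>\<delta>\<close> and hence finite, so \<^const>\<open>enn2real\<close> loses nothing.\<close>

definition hausdorff_premeasure_w ::
    "(real ^ 'd::finite \<Rightarrow> real) \<Rightarrow> real \<Rightarrow> real \<Rightarrow> (real ^ 'd) set \<Rightarrow> ennreal" where
  "hausdorff_premeasure_w w s \<delta> X =
     Inf {(\<Sum>i. ennreal (enn2real (diam_w w (U i)) powr s)) |U :: nat \<Rightarrow> (real ^ 'd) set.
       (\<forall>i. open (U i) \<and> diam_w w (U i) < ennreal \<delta>) \<and> X \<subseteq> (\<Union>i. U i)}"

definition hausdorff_measure_w ::
    "(real ^ 'd::finite \<Rightarrow> real) \<Rightarrow> real \<Rightarrow> (real ^ 'd) set \<Rightarrow> ennreal" where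
  "hausdorff_measure_w w s X = Lim (at_right 0) (\<lambda>\<delta>. hausdorff_premeasure_w w s \<delta> X)"

text \<open>The infimum is taken in \<open>[0,\<infinity>]\<close>, so it is \<open>\<infinity>\<close> if no \<open>s\<close> qualifies.
  It also equals the supremum of all \<open>s\<close> with infinite measure (\<open>0\<close> if there are none).\<close>

definition hausdorff_dim_w :: "(real ^ 'd::finite \<Rightarrow> real) \<Rightarrow> (real ^ 'd) set \<Rightarrow> ennreal" where
  "hausdorff_dim_w w X = Inf {ennreal s |s. 0 < s \<and> hausdorff_measure_w w s X = 0}"

end

theory Submission
  imports Defs "HOL-Computational_Algebra.Fundamental_Theorem_Algebra"
begin

text \<open>
  Inflating a prototile by \<open>Q ^^ N\<close> for large \<open>N\<close> produces a patch one of whose tiles lies in the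
  interior of the inflated tile, and this tile is not needed to cover the boundary.  So the boundary
  is covered by the boundaries of tiles whose total interior volume is at most \<open>\<rho>\<close> times that of
  the prototile, with \<open>\<rho> < \<bar>det Q\<bar> ^ N\<close>.  Iterating \<open>n\<close> times and scaling back, \<open>O(\<rho> ^ n)\<close> open
  sets of \<open>w\<close>-diameter \<open>O(\<bar>det Q\<bar> powr (- n N / d))\<close> cover the boundary, and the resulting sums of
  \<open>s\<close>-th powers tend to 0 for some \<open>s < d\<close>.  Only interiors are measured, so that nothing has to be
  known about the volume of the boundary itself.
\<close>

section \<open>Expansive maps have unbounded orbits\<close>

text \<open>This is \<open>p(M) v\<close>: the polynomial \<open>p\<close> evaluated at the matrix
  \<open>M\<close> and applied to the vector \<open>v\<close>.\<close>

definition krylov :: "complex ^ 'n ^ 'n \<Rightarrow> complex ^ 'n \<Rightarrow> complex poly \<Rightarrow> complex ^ 'n::finite" where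
  "krylov M v p = (\<Sum>k\<le>degree p. coeff p k *s ((*v) M ^^ k) v)"

lemma krylov_altdef:
  assumes "degree p \<le> n"
  shows "krylov M v p = (\<Sum>k\<le>n. coeff p k *s ((*v) M ^^ k) v)"
  unfolding krylov_def using assms
  by (intro sum.mono_neutral_left) (auto simp: coeff_eq_0)

lemma matrix_vector_mult_sum_scaled:
  fixes M :: "complex ^ 'n ^ 'm"
  shows "M *v (\<Sum>k\<in>K. c k *s f k) = (\<Sum>k\<in>K. c k *s (M *v f k))"
  by (induction K rule: infinite_finite_induct) (simp_all add: matrix_vector_right_distrib vector_scalar_commute)

text \<open>Multiplication by \<open>X\<close> shifts the coefficients of \<open>q\<close>, which
  amounts to one more application of \<open>M\<close>, so the factor \<open>X - z\<close> acts as
  \<open>M - z\<close>. This is how a root of an annihilating polynomial becomes an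
  eigenvalue.\<close>

lemma krylov_linear_factor:
  "krylov M v ([:- z, 1:] * q) = M *v krylov M v q - z *s krylov M v q"
proof -
  define n where "n = degree q"
  have "krylov M v ([:- z, 1:] * q) =
      (\<Sum>k\<le>Suc n. coeff ([:- z, 1:] * q) k *s ((*v) M ^^ k) v)"
    by (rule krylov_altdef) (use degree_mult_le[of "[:- z, 1:]" q] in \<open>simp add: n_def\<close>)
  also have "\<dots> = (\<Sum>k\<le>Suc n. (coeff (pCons 0 q) k *s ((*v) M ^^ k) v) + - (z *s (coeff q k *s ((*v) M ^^ k) v)))"
    by (intro sum.cong refl) (simp add: vec_eq_iff algebra_simps)
  also have "\<dots> = (\<Sum>k\<le>Suc n. coeff (pCons 0 q) k *s ((*v) M ^^ k) v)
      - z *s (\<Sum>k\<le>Suc n. coeff q k *s ((*v) M ^^ k) v)"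
    by (simp only: sum.distrib sum_negf vec.scale_sum_right) simp
  also have "(\<Sum>k\<le>Suc n. coeff q k *s ((*v) M ^^ k) v) = krylov M v q"
    by (rule krylov_altdef[symmetric]) (simp add: n_def)
  also have "(\<Sum>k\<le>Suc n. coeff (pCons 0 q) k *s ((*v) M ^^ k) v) = M *v krylov M v q"
    unfolding krylov_def n_def[symmetric]
    by (simp add: sum.atMost_Suc_shift matrix_vector_mult_sum_scaled del: sum.atMost_Suc)
  finally show ?thesis .
qed

text \<open>The iterates of \<open>v\<close> up to exponent \<open>n\<close> are
  \<open>n + 1\<close> vectors in a space of real dimension \<open>n\<close>; a linear relation
  among them is read as a polynomial. Its coefficients are real numbers, embedded into the complex
  ones.\<close>

lemma exists_annihilating_poly:
  fixes M :: "complex ^ 'n::finite ^ 'n"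
  shows "\<exists>p\<noteq>0. krylov M v p = 0"
proof -
  define W where "W k = ((*v) M ^^ k) v" for k
  define n where "n = DIM(complex ^ 'n)"
  show ?thesis
  \<comment> \<open>Dependence of a set does not see repetitions, so coinciding iterates are treated
    separately: there a difference of two monomials annihilates \<open>v\<close>.\<close>
  proof (cases "inj_on W {..n}")
    case False
    then obtain k l where kl: "k \<noteq> l" "W k = W l"
      by (auto simp: inj_on_def)
    let ?p = "monom 1 k - monom 1 l :: complex poly"
    have "degree ?p \<le> max k l"
      by (intro degree_diff_le) (auto simp: degree_monom_eq)
    then have "krylov M v ?p = (\<Sum>j\<le>max k l. coeff ?p j *s W j)"
      by (simp add: krylov_altdef W_def)
    also have "\<dots> = (\<Sum>j\<le>max k l. (if j = k then W j else 0)) - (\<Sum>j\<le>max k l. (if j = l then W j else 0))"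
      unfolding sum_subtractf[symmetric] by (intro sum.cong refl) (auto simp: vec_eq_iff)
    also have "\<dots> = 0"
      using kl by simp
    finally have "krylov M v ?p = 0" .
    moreover have "?p \<noteq> 0"
      using kl by (metis monom_eq_iff' one_neq_zero right_minus_eq)
    ultimately show ?thesis by blast
  next
    case True
    then have "card (W ` {..n}) = Suc n"
      by (simp add: card_image)
    then have "dependent (W ` {..n})"
      by (intro dependent_biggerset) (simp add: n_def)
    then obtain u x where u: "(\<Sum>y\<in>W ` {..n}. u y *\<^sub>R y) = 0" and x: "x \<in> W ` {..n}" "u x \<noteq> 0"
      by (auto simp: dependent_finite)
    define p where "p = (\<Sum>k\<le>n. monom (complex_of_real (u (W k))) k)"
    have coeff: "coeff p k = (if k \<le> n then complex_of_real (u (W k)) else 0)" for k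
      by (simp add: p_def coeff_sum coeff_monom)
    have "degree p \<le> n"
      by (intro degree_le) (simp add: coeff)
    then have "krylov M v p = (\<Sum>k\<le>n. coeff p k *s W k)"
      by (simp add: krylov_altdef W_def)
    also have "\<dots> = (\<Sum>k\<le>n. u (W k) *\<^sub>R W k)"
      by (intro sum.cong refl) (simp add: coeff vec_eq_iff scaleR_conv_of_real[where 'a = complex])
    also have "\<dots> = 0"
      using u True by (simp add: sum.reindex)
    finally have "krylov M v p = 0" .
    moreover have "p \<noteq> 0"
      using x coeff by (metis (no_types, lifting) atMost_iff coeff_0 imageE of_real_eq_0_iff)
    ultimately show ?thesis by blast
  qed
qed

text \<open>Among the nonzero polynomials with \<open>p(M) v = 0\<close> one of least degree is
  taken, and a root \<open>z\<close> is split off as \<open>p = (X - z) q\<close>. Minimality gives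
  \<open>q(M) v \<noteq> 0\<close>, while \<open>M - z\<close> sends this vector to
  \<open>p(M) v = 0\<close>.\<close>

lemma complex_matrix_has_eigenvector:
  fixes M :: "complex ^ 'n::finite ^ 'n"
  obtains c v where "v \<noteq> 0" "M *v v = c *s v"
proof -
  obtain v :: "complex ^ 'n" where v: "v \<noteq> 0"
    by (meson axis_eq_0_iff one_neq_zero)
  define p where "p = arg_min degree (\<lambda>p. p \<noteq> 0 \<and> krylov M v p = 0)"
  obtain r where r: "r \<noteq> 0 \<and> krylov M v r = 0"
    using exists_annihilating_poly by blast
  have p: "p \<noteq> 0" "krylov M v p = 0"
    using arg_min_natI[of "\<lambda>p. p \<noteq> 0 \<and> krylov M v p = 0", OF r] unfolding p_def by auto
  have least: "degree p \<le> degree q" if "q \<noteq> 0" "krylov M v q = 0" for q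
    unfolding p_def using that by (intro arg_min_nat_le) auto
  have "degree p \<noteq> 0"
  proof
    assume "degree p = 0"
    then obtain a where "p = [:a:]" by (auto elim: degree_eq_zeroE)
    moreover from this have "krylov M v p = a *s v" by (simp add: krylov_def)
    ultimately show False using p(1,2) v by (simp add: vector_mul_eq_0)
  qed
  then obtain z where "poly p z = 0"
    using fundamental_theorem_of_algebra[of p] by (auto simp: constant_degree)
  then obtain q where q: "p = [:- z, 1:] * q"
    by (auto simp: poly_eq_0_iff_dvd)
  with p have "q \<noteq> 0" by auto
  then have "degree p = Suc (degree q)"
    unfolding q by (subst degree_mult_eq) auto
  with least \<open>q \<noteq> 0\<close> have "krylov M v q \<noteq> 0" by fastforce
  moreover have "M *v krylov M v q = z *s krylov M v q"
    using p(2) unfolding q krylov_linear_factor by simp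
  ultimately show thesis by (rule that)
qed

text \<open>The matrix of \<open>Q\<close> is real, so it commutes with taking real parts of
  coordinates.\<close>

lemma funpow_Re_eigenvector:
  fixes Q :: "real ^ 'd::finite \<Rightarrow> real ^ 'd"
  assumes "linear Q" and "map_matrix complex_of_real (matrix Q) *v v = c *s v"
  shows "(Q ^^ n) (\<chi> k. Re (v $ k)) = (\<chi> k. Re (c ^ n * v $ k))"
proof (induction n)
  case (Suc n)
  have *: "Q (\<chi> k. Re (y $ k)) = (\<chi> k. Re ((map_matrix complex_of_real (matrix Q) *v y) $ k))" for y
    by (subst matrix_vector_mul(2)[OF assms(1), symmetric])
       (simp add: matrix_vector_mult_def vec_eq_iff map_matrix_def)
  have "(Q ^^ Suc n) (\<chi> k. Re (v $ k)) = Q (\<chi> k. Re ((c ^ n *s v) $ k))"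
    by (simp add: Suc)
  also have "\<dots> = (\<chi> k. Re (c ^ Suc n * v $ k))"
    unfolding * vector_scalar_commute assms(2) by (simp add: vec_eq_iff mult_ac)
  finally show ?case .
qed simp

text \<open>If all orbits were bounded, so would be the real and imaginary parts of
  \<open>c ^ n * v $ k\<close> for an eigenvector \<open>v\<close> with
  \<open>v $ k \<noteq> 0\<close>, against \<open>1 < norm c\<close>.\<close>

lemma expansive_unbounded_orbit:
  fixes Q :: "real ^ 'd::finite \<Rightarrow> real ^ 'd"
  assumes "expansive Q"
  shows "\<exists>x. \<not> bounded (range (\<lambda>n. (Q ^^ n) x))"
proof (rule ccontr)
  assume "\<nexists>x. \<not> bounded (range (\<lambda>n. (Q ^^ n) x))"
  then have bdd: "bounded (range (\<lambda>n. (Q ^^ n) x))" for x by blast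
  define M where "M = map_matrix complex_of_real (matrix Q)"
  obtain c v where cv: "v \<noteq> 0" "M *v v = c *s v"
    using complex_matrix_has_eigenvector .
  have Q: "linear Q" and c: "1 < norm c"
    using assms cv unfolding expansive_def complex_eigenvalue_def M_def by blast+
  obtain k where k: "v $ k \<noteq> 0"
    using cv(1) by (auto simp: vec_eq_iff)
  have Re_bdd: "\<exists>B. \<forall>n. \<bar>Re (c ^ n * y $ k)\<bar> \<le> B" if "M *v y = c *s y" for y
  proof -
    obtain B where B: "\<And>n. norm ((Q ^^ n) (\<chi> k. Re (y $ k))) \<le> B"
      using bdd[of "\<chi> k. Re (y $ k)"] unfolding bounded_iff by auto
    have "\<bar>Re (c ^ n * y $ k)\<bar> \<le> B" for n
      using order_trans[OF component_le_norm_cart B[of n], of k]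
        funpow_Re_eigenvector[OF Q that[unfolded M_def]] by simp
    then show ?thesis by blast
  qed
  obtain B1 where B1: "\<And>n. \<bar>Re (c ^ n * v $ k)\<bar> \<le> B1"
    using Re_bdd cv(2) by blast
  \<comment> \<open>\<open>- \<i> *s v\<close> is an eigenvector for the same \<open>c\<close>, and
    the real parts of its coordinates are the imaginary parts of those of \<open>v\<close>.\<close>
  have "M *v (- \<i> *s v) = c *s (- \<i> *s v)"
    unfolding vector_scalar_commute cv(2) by (simp add: vec_eq_iff)
  then obtain B2 where "\<And>n. \<bar>Re (c ^ n * (- \<i> *s v) $ k)\<bar> \<le> B2"
    using Re_bdd by blast
  then have B2: "\<bar>Im (c ^ n * v $ k)\<bar> \<le> B2" for n
    by (auto simp: algebra_simps)
  have "norm c ^ n * norm (v $ k) \<le> B1 + B2" for n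
    using cmod_le[of "c ^ n * v $ k"] B1[of n] B2[of n] by (simp add: norm_mult norm_power)
  then have "norm c ^ n \<le> (B1 + B2) / norm (v $ k)" for n
    using k by (simp add: field_simps)
  then show False
    using real_arch_pow[OF c] by (metis not_less)
qed

section \<open>Volumes of linear images\<close>

lemma linear_image_translation:
  assumes "linear f"
  shows "f ` (+) a ` S = (+) (f a) ` f ` S"
  by (auto simp: image_image linear_add[OF assms])

text \<open>\<open>measure_linear_sufficient\<close> reduces the scaling of measurable sets to that
  of boxes, which for a determinant of absolute value 1 only have to keep their volume.\<close>

lemma measure_image_unimodular:
  fixes f :: "real ^ 'n \<Rightarrow> real ^ 'n::finite"
  assumes "linear f" "\<bar>det (matrix f)\<bar> = 1" "S \<in> lmeasurable"
    and "\<And>a b. cbox a b \<noteq> {} \<Longrightarrow> measure lebesgue (f ` cbox a b) = measure lebesgue (cbox a b)"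
  shows "f ` S \<in> lmeasurable \<and> measure lebesgue (f ` S) = \<bar>det (matrix f)\<bar> * measure lebesgue S"
proof -
  have "measure lebesgue (f ` cbox a b) = 1 * measure lebesgue (cbox a b)" for a b
    using assms(4)[of a b] by (cases "cbox a b = {}") auto
  then show ?thesis
    using measure_linear_sufficient[OF assms(1,3)] assms(2) by fastforce
qed

text \<open>A box goes to the box with two sides exchanged. The matrix is the identity with two rows
  exchanged, so its determinant is -1.\<close>

lemma measure_swap_image:
  fixes S :: "(real ^ 'n::finite) set" and m n :: 'n
  defines "f \<equiv> \<lambda>x::real ^ 'n. \<chi> i. x $ Transposition.transpose m n i"
  assumes "m \<noteq> n" "S \<in> lmeasurable"
  shows "f ` S \<in> lmeasurable \<and> measure lebesgue (f ` S) = \<bar>det (matrix f)\<bar> * measure lebesgue S"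
proof (rule measure_image_unimodular)
  show "linear f"
    by (rule linearI) (simp_all add: f_def vec_eq_iff)
  have "matrix f = (\<chi> i. mat 1 $ Transposition.transpose m n i)"
    by (simp add: f_def matrix_def mat_def axis_def vec_eq_iff)
  then show "\<bar>det (matrix f)\<bar> = 1"
    by (simp add: det_permute_rows permutes_swap_id sign_swap_id assms(2) del: vec_lambda_eta)
  fix a b :: "real ^ 'n"
  assume ne: "cbox a b \<noteq> {}"
  \<comment> \<open>Being its own inverse, \<open>f\<close> maps onto the whole exchanged
    box.\<close>
  have f_f: "f (f x) = x" for x
    by (simp add: f_def vec_eq_iff)
  have f_le: "(\<forall>i. f x $ i \<le> f y $ i) \<longleftrightarrow> (\<forall>i. x $ i \<le> y $ i)" for x y
    unfolding f_def by (metis transpose_involutory vec_lambda_beta)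
  have mem: "f x \<in> cbox (f a) (f b) \<longleftrightarrow> x \<in> cbox a b" for x
    using f_le[of a x] f_le[of x b] by (simp add: mem_box_cart all_conj_distrib)
  have eq: "f ` cbox a b = cbox (f a) (f b)"
  proof (intro set_eqI iffI)
    fix y assume "y \<in> cbox (f a) (f b)"
    then show "y \<in> f ` cbox a b"
      using mem[of "f y"] f_f by (metis image_eqI)
  qed (use mem in auto)
  moreover have "prod (\<lambda>i. f b $ i - f a $ i) UNIV = prod (\<lambda>i. b $ i - a $ i) UNIV"
    using prod.permute[OF permutes_swap_id[of m UNIV n], of "\<lambda>i. b $ i - a $ i"]
    by (simp add: f_def o_def)
  moreover have "cbox (f a) (f b) \<noteq> {}"
    using ne eq by auto
  ultimately show "measure lebesgue (f ` cbox a b) = measure lebesgue (cbox a b)"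
    using ne by (simp add: content_cbox_cart)
qed (fact assms(3))

text \<open>Adding one row of the identity to another keeps the determinant 1; on boxes
  \<open>measure_shear_interval\<close> applies.\<close>

lemma measure_shear_image:
  fixes S :: "(real ^ 'n::finite) set" and m n :: 'n
  defines "f \<equiv> \<lambda>x::real ^ 'n. \<chi> i. if i = m then x $ m + x $ n else x $ i"
  assumes "m \<noteq> n" "S \<in> lmeasurable"
  shows "f ` S \<in> lmeasurable \<and> measure lebesgue (f ` S) = \<bar>det (matrix f)\<bar> * measure lebesgue S"
proof (rule measure_image_unimodular)
  show f: "linear f"
    by (rule linearI) (simp_all add: f_def vec_eq_iff algebra_simps)
  have "matrix f = (\<chi> k. if k = m then row m (mat 1) + 1 *s row n (mat 1) else row k (mat 1))"
    by (auto simp: f_def matrix_def mat_def axis_def row_def vec_eq_iff)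
  then show "\<bar>det (matrix f)\<bar> = 1"
    using det_row_operation[OF assms(2), of "mat 1 :: real ^ 'n ^ 'n" 1] by (simp del: vec_lambda_eta)
  fix a b :: "real ^ 'n"
  assume ne: "cbox a b \<noteq> {}"
  \<comment> \<open>The library treats boxes on the side \<open>0 \<le> x\<^sub>n\<close> only; move the given box there.\<close>
  define t where "t = axis n (a $ n)"
  have box: "cbox a b = (+) t ` cbox (a - t) (b - t)"
    by (simp add: cbox_translation[symmetric])
  then have "measure lebesgue (f ` cbox a b) = measure lebesgue (f ` cbox (a - t) (b - t))"
    by (simp add: linear_image_translation[OF f] measure_translation)
  also have "\<dots> = measure lebesgue (cbox (a - t) (b - t))"
    unfolding f_def using ne box assms(2) by (intro measure_shear_interval) (auto simp: t_def)
  also have "\<dots> = measure lebesgue (cbox a b)"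
    by (simp only: box measure_translation)
  finally show "measure lebesgue (f ` cbox a b) = measure lebesgue (cbox a b)" .
qed (fact assms(3))

text \<open>The library proves this for wellordered index types only, although just the determinants of
  the elementary maps need care.\<close>

lemma measure_linear_image_finite:
  fixes f :: "real ^ 'n \<Rightarrow> real ^ 'n::finite"
  assumes "linear f" "S \<in> lmeasurable"
  shows "f ` S \<in> lmeasurable \<and> measure lebesgue (f ` S) = \<bar>det (matrix f)\<bar> * measure lebesgue S"
proof -
  have "\<forall>S\<in>lmeasurable. f ` S \<in> lmeasurable \<and>
    measure lebesgue (f ` S) = \<bar>det (matrix f)\<bar> * measure lebesgue S"
  proof (induction rule: induct_linear_elementary[OF assms(1)])
    case (1 f g)
    show ?case
    proof (intro ballI)
      fix S :: "(real ^ 'n) set"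
      assume "S \<in> lmeasurable"
      then have g: "g ` S \<in> lmeasurable" "measure lebesgue (g ` S) = \<bar>det (matrix g)\<bar> * measure lebesgue S"
        using 1(4) by blast+
      have "matrix (f \<circ> g) = matrix f ** matrix g"
        using 1(1,2) by (intro matrix_compose)
      moreover have "(f \<circ> g) ` S = f ` g ` S"
        by (rule image_comp[symmetric])
      ultimately show "(f \<circ> g) ` S \<in> lmeasurable \<and>
          measure lebesgue ((f \<circ> g) ` S) = \<bar>det (matrix (f \<circ> g))\<bar> * measure lebesgue S"
        using 1(3)[rule_format, OF g(1)] g(2) by (simp only: det_mul abs_mult mult.assoc simp_thms)
    qed
  next
    case (2 f i)
    \<comment> \<open>All values of \<open>f\<close> have \<open>i\<close>-th coordinate 0, so
      \<open>f\<close> is not onto, hence singular: both sides of the formula vanish.\<close>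
    have "f x \<noteq> axis i 1" for x
      using 2(2)[of x] by (metis axis_nth one_neq_zero)
    then have "\<not> inj f"
      using linear_injective_imp_surjective[OF 2(1)] by (metis surjD)
    then show ?case
      using negligible_linear_singular_image[OF 2(1)] det_nz_iff_inj[OF 2(1)]
      by (auto simp: negligible_iff_measure)
  next
    case (3 c)
    have "matrix (\<lambda>x. \<chi> i. c i * x $ i) = (\<chi> i j. if i = j then c i else 0)"
      by (simp add: matrix_def axis_def vec_eq_iff)
    then have "det (matrix (\<lambda>x. \<chi> i. c i * x $ i)) = prod c UNIV"
      by (simp add: det_diagonal)
    then show ?case
      by (simp add: measurable_stretch measure_stretch)
  qed (simp_all add: measure_swap_image measure_shear_image)
  then show ?thesis
    using assms(2) by blast
qed

section \<open>Pseudo norms and Hausdorff measures\<close>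

lemma linear_funpow:
  fixes f :: "'a::real_vector \<Rightarrow> 'a"
  assumes "linear f"
  shows "linear (f ^^ n)"
proof (induction n)
  case 0
  show ?case by (simp add: linear_iff)
next
  case (Suc n)
  show ?case
    unfolding funpow.simps by (rule linear_compose[OF Suc assms])
qed

lemma det_matrix_funpow:
  fixes f :: "real ^ 'd \<Rightarrow> real ^ 'd::finite"
  assumes "linear f"
  shows "det (matrix (f ^^ n)) = det (matrix f) ^ n"
proof (induction n)
  case 0
  then show ?case by (simp add: id_def matrix_id[unfolded id_def] det_I)
next
  case (Suc n)
  have "matrix (f ^^ Suc n) = matrix f ** matrix (f ^^ n)"
    by (simp only: funpow.simps matrix_compose[OF linear_funpow[OF assms] assms])
  then show ?case
    by (simp only: det_mul Suc power_Suc)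
qed

text \<open>The factor by which \<open>Q\<close> multiplies every corresponding pseudo norm.\<close>

definition dilation :: "(real ^ 'd \<Rightarrow> real ^ 'd::finite) \<Rightarrow> real" where
  "dilation Q = \<bar>det (matrix Q)\<bar> powr (1 / real CARD('d))"

lemma pseudo_norm_funpow:
  assumes "pseudo_norm Q w"
  shows "w ((Q ^^ n) x) = dilation Q ^ n * w x"
  using assms by (induction n) (simp_all add: pseudo_norm_def dilation_def)

text \<open>A Euclidean ball is open, so the topology conjunct of \<open>pseudo_norm\<close> puts a
  \<open>w\<close>-ball around its centre inside it.\<close>

lemma pseudo_norm_small_imp_norm_small:
  assumes "pseudo_norm Q w" "0 < r"
  obtains \<epsilon> where "0 < \<epsilon>" "\<And>y. w y < \<epsilon> \<Longrightarrow> norm y < r"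
proof -
  have "\<forall>x\<in>ball 0 r. \<exists>\<epsilon>>0. \<forall>y. w (y - x) < \<epsilon> \<longrightarrow> y \<in> ball 0 r"
    using assms(1) open_ball[of 0 r] unfolding pseudo_norm_def by meson
  then have "\<exists>\<epsilon>>0. \<forall>y. w (y - 0) < \<epsilon> \<longrightarrow> y \<in> ball 0 r"
    by (rule bspec) (simp add: assms(2))
  then show thesis
    using that by auto
qed

lemma pseudo_norm_bounded_on_cball:
  assumes "pseudo_norm Q w"
  obtains K where "0 < K" "\<And>y. norm y \<le> r \<Longrightarrow> w y \<le> K"
proof -
  have "continuous_on (cball 0 r) w"
    using assms unfolding pseudo_norm_def by (meson continuous_on_subset subset_UNIV)
  then have "bounded (w ` cball 0 r)"
    by (intro compact_imp_bounded compact_continuous_image compact_cball)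
  then obtain K where K: "0 < K" "\<forall>t\<in>w ` cball 0 r. norm t \<le> K"
    unfolding bounded_pos by blast
  have "w y \<le> K" if "norm y \<le> r" for y
    using K(2) that by (fastforce simp: abs_le_iff)
  with K(1) show thesis by (rule that)
qed

text \<open>Instead of writing \<open>det Q\<close> as the product of the eigenvalues: if \<open>\<bar>det Q\<bar> \<le> 1\<close> then \<open>w\<close> does not
  increase along orbits, so all orbits are bounded, contrary to expansivity.\<close>

lemma dilation_gt_1:
  assumes "expansive Q" "pseudo_norm Q w"
  shows "1 < dilation Q"
proof (rule ccontr)
  assume "\<not> 1 < dilation Q"
  then have le: "dilation Q \<le> 1" and ge: "0 \<le> dilation Q"
    by (simp_all add: dilation_def)
  have Q: "linear Q"
    using assms(1) by (simp add: expansive_def)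
  have w: "continuous_on UNIV w" "\<And>x. 0 \<le> w x" "w 0 = 0"
    using assms(2) by (auto simp: pseudo_norm_def)
  obtain \<epsilon> where \<epsilon>: "0 < \<epsilon>" "\<And>y. w y < \<epsilon> \<Longrightarrow> norm y < 1"
    using pseudo_norm_small_imp_norm_small[OF assms(2), of 1] by auto
  obtain \<delta> where \<delta>: "0 < \<delta>" "\<And>y. norm y < \<delta> \<Longrightarrow> w y < \<epsilon>"
    using w(1) \<epsilon>(1) unfolding continuous_on_iff
    by (metis UNIV_I abs_of_nonneg diff_zero dist_0_norm dist_commute dist_real_def w(2,3))
  have "bounded (range (\<lambda>n. (Q ^^ n) x))" for x
  proof -
    \<comment> \<open>Scaling by \<open>t\<close> brings \<open>x\<close> into the
      \<open>\<delta>\<close>-ball, so the orbit of the scaled point keeps \<open>w\<close> below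
      \<open>\<epsilon>\<close> and stays in the unit ball; linearity transfers this to
      \<open>x\<close>. The \<open>+ 1\<close> covers \<open>x = 0\<close>.\<close>
    define t where "t = \<delta> / 2 / (norm x + 1)"
    have t: "0 < t"
      using \<delta>(1) by (simp add: t_def add_nonneg_pos)
    have "t * norm x \<le> t * (norm x + 1)"
      using t by simp
    also have "\<dots> = \<delta> / 2"
    proof -
      have "norm x + 1 \<noteq> 0"
        using norm_ge_zero[of x] by linarith
      then show ?thesis
        unfolding t_def by (metis nonzero_mult_div_cancel_right times_divide_eq_left)
    qed
    also have "\<dots> < \<delta>" using \<delta>(1) by simp
    finally have "w (t *\<^sub>R x) < \<epsilon>"
      using t by (intro \<delta>(2)) simp
    then have "w ((Q ^^ n) (t *\<^sub>R x)) < \<epsilon>" for n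
      using le ge w(2)[of "t *\<^sub>R x"]
      by (auto simp: pseudo_norm_funpow[OF assms(2)] intro: le_less_trans[OF mult_left_le_one_le] power_le_one)
    then have "norm (t *\<^sub>R (Q ^^ n) x) < 1" for n
      using \<epsilon>(2) by (metis linear_scale linear_funpow[OF Q])
    then have "norm ((Q ^^ n) x) \<le> 1 / t" for n
      using t by (simp add: field_simps less_imp_le)
    then show ?thesis
      by (auto simp: bounded_iff)
  qed
  then show False
    using expansive_unbounded_orbit[OF assms(1)] by blast
qed

lemma dilation_power_card:
  fixes Q :: "real ^ 'd \<Rightarrow> real ^ 'd::finite"
  shows "dilation Q ^ CARD('d) = \<bar>det (matrix Q)\<bar>"
  by (cases "det (matrix Q) = 0")
     (auto simp: dilation_def powr_realpow[symmetric] powr_powr zero_power)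

text \<open>The \<open>n\<close>-th cover contributes at most \<open>C * \<rho> ^ n * (K * \<kappa>
  ^ n) powr s = C * K powr s * (\<rho> * \<kappa> powr s) ^ n\<close>, which tends to 0, as do the
  diameters.\<close>

lemma hausdorff_measure_w_eq_0:
  fixes w :: "real ^ 'd::finite \<Rightarrow> real"
  assumes pos: "0 < s" "0 < K" "0 < \<kappa>" "\<kappa> < 1" "0 \<le> \<rho>" and small: "\<rho> * \<kappa> powr s < 1"
    and cover: "\<And>n. \<exists>F. finite F \<and> real (card F) \<le> C * \<rho> ^ n \<and> X \<subseteq> \<Union>F \<and>
          (\<forall>U\<in>F. open U \<and> diam_w w U \<le> ennreal (K * \<kappa> ^ n))"
  shows "hausdorff_measure_w w s X = 0"
proof -
  have "hausdorff_premeasure_w w s \<delta> X = 0" if \<delta>: "0 < \<delta>" for \<delta>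
  proof -
    have "hausdorff_premeasure_w w s \<delta> X \<le> ennreal e" if e: "0 < e" for e
    proof -
      define q where "q = \<rho> * \<kappa> powr s"
      have q: "0 \<le> q" "q < 1"
        using pos small by (simp_all add: q_def)
      have "(\<lambda>n. K * \<kappa> ^ n) \<longlonglongrightarrow> K * 0"
        using pos by (intro tendsto_intros LIMSEQ_realpow_zero) auto
      then have "\<forall>\<^sub>F n in sequentially. K * \<kappa> ^ n < \<delta>"
        using \<delta> by (intro order_tendstoD(2)) simp_all
      moreover have "(\<lambda>n. C * K powr s * q ^ n) \<longlonglongrightarrow> C * K powr s * 0"
        using q by (intro tendsto_intros LIMSEQ_realpow_zero) auto
      then have "\<forall>\<^sub>F n in sequentially. C * K powr s * q ^ n < e"
        using e by (intro order_tendstoD(2)) simp_all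
      ultimately have "\<forall>\<^sub>F n in sequentially. K * \<kappa> ^ n < \<delta> \<and> C * K powr s * q ^ n < e"
        by (rule eventually_conj)
      then obtain n where n: "K * \<kappa> ^ n < \<delta>" "C * K powr s * q ^ n < e"
        by (auto dest!: eventually_happens'[OF sequentially_bot])
      define h where "h = K * \<kappa> ^ n"
      have h: "0 < h" "h < \<delta>"
        using pos n by (simp_all add: h_def)
      obtain F where F: "finite F" "real (card F) \<le> C * \<rho> ^ n" "X \<subseteq> \<Union>F"
        "\<And>U. U \<in> F \<Longrightarrow> open U" "\<And>U. U \<in> F \<Longrightarrow> diam_w w U \<le> ennreal h"
        using cover[of n] by (auto simp: h_def)
      obtain xs where xs: "set xs = F" "distinct xs"
        using finite_distinct_list[OF F(1)] by blast
      \<comment> \<open>The finite cover is padded to a sequence by empty sets, each of diameter 0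
        and contributing \<open>0 powr s = 0\<close>.\<close>
      define U where "U i = (if i < length xs then xs ! i else {})" for i
      have U_in: "U i \<in> F" if "i < length xs" for i
        using that xs by (auto simp: U_def)
      have U: "open (U i) \<and> diam_w w (U i) < ennreal \<delta>" for i
      proof (cases "i < length xs")
        case True
        have "diam_w w (U i) \<le> ennreal h" using F(5) U_in[OF True] by blast
        also have "\<dots> < ennreal \<delta>" using h by (simp add: ennreal_lessI)
        finally show ?thesis using F(4) U_in[OF True] by blast
      qed (use \<delta> in \<open>simp add: U_def diam_w_def bot_ennreal\<close>)
      have "X \<subseteq> (\<Union>i. U i)"
      proof
        fix x assume "x \<in> X"
        then obtain V where "V \<in> F" "x \<in> V" using F(3) by blast
        moreover from this obtain i where "i < length xs" "xs ! i = V"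
          unfolding xs(1)[symmetric] by (auto simp: in_set_conv_nth)
        ultimately show "x \<in> (\<Union>i. U i)" by (auto simp: U_def)
      qed
      then have "hausdorff_premeasure_w w s \<delta> X
          \<le> (\<Sum>i. ennreal (enn2real (diam_w w (U i)) powr s))"
        unfolding hausdorff_premeasure_w_def using U by (intro Inf_lower) blast
      also have "\<dots> = (\<Sum>i<length xs. ennreal (enn2real (diam_w w (U i)) powr s))"
        by (intro suminf_finite) (auto simp: U_def diam_w_def bot_ennreal)
      also have "\<dots> \<le> (\<Sum>i<length xs. ennreal (h powr s))"
      proof (intro sum_mono ennreal_leI powr_mono2)
        fix i assume "i \<in> {..<length xs}"
        then have "enn2real (diam_w w (U i)) \<le> enn2real (ennreal h)"
          using F(5) U_in by (intro enn2real_mono) auto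
        then show "enn2real (diam_w w (U i)) \<le> h"
          using h by simp
      qed (use pos in auto)
      also have "\<dots> = ennreal (real (length xs) * h powr s)"
        by (simp add: ennreal_mult ennreal_of_nat_eq_real_of_nat)
      also have "\<dots> \<le> ennreal e"
      proof (intro ennreal_leI)
        have "real (length xs) = real (card F)"
          using xs distinct_card by force
        then have le: "real (length xs) * h powr s \<le> C * \<rho> ^ n * h powr s"
          using F(2) by (intro mult_right_mono) auto
        have "h powr s = K powr s * (\<kappa> powr s) ^ n"
          using pos by (simp add: h_def powr_mult powr_realpow[symmetric] powr_powr mult.commute)
        with le show "real (length xs) * h powr s \<le> e"
          using n(2) by (simp add: q_def power_mult_distrib mult_ac)
      qed
      finally show ?thesis .
    qed
    then have "hausdorff_premeasure_w w s \<delta> X \<le> 0"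
      by (metis ennreal_le_epsilon add_0)
    then show ?thesis by simp
  qed
  then have "\<forall>\<^sub>F \<delta> in at_right 0. hausdorff_premeasure_w w s \<delta> X = 0"
    by (auto simp: eventually_at_filter)
  then have "((\<lambda>\<delta>. hausdorff_premeasure_w w s \<delta> X) \<longlongrightarrow> 0) (at_right 0)"
    by (rule tendsto_eventually)
  then show ?thesis
    unfolding hausdorff_measure_w_def by (intro tendsto_Lim) auto
qed

section \<open>Subdivisions of inflated tiles\<close>

text \<open>A pair of a vector and a type encodes a translated prototile, so volume sums can run
  over finite sets of pairs.\<close>

definition placed :: "('m \<Rightarrow> (real ^ 'd) set) \<Rightarrow> (real ^ 'd) \<times> 'm \<Rightarrow> (real ^ 'd::finite) set" where
  "placed A p = (+) (fst p) ` A (snd p)"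

text \<open>\<open>is_tile\<close> admits the empty set. Excluding empty pieces gives every piece an
  interior of positive volume once the prototiles are tiles.\<close>

definition subdivision ::
    "('m \<Rightarrow> (real ^ 'd::finite) set) \<Rightarrow> (real ^ 'd) set \<Rightarrow> ((real ^ 'd) \<times> 'm) set \<Rightarrow> bool" where
  "subdivision A S P \<longleftrightarrow>
     finite P \<and> S = \<Union>(placed A ` P) \<and> (\<forall>p\<in>P. A (snd p) \<noteq> {}) \<and>
     disjoint_family_on (\<lambda>p. interior (placed A p)) P"

lemma placed_shift: "(+) a ` placed A p = placed A (a + fst p, snd p)"
  by (simp add: placed_def image_image add.assoc)

lemma interior_placed: "interior (placed A p) = (+) (fst p) ` interior (A (snd p))"
  by (simp add: placed_def interior_translation)

lemma frontier_injective_linear_image: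
  fixes f :: "'a::euclidean_space \<Rightarrow> 'a"
  assumes "linear f" "inj f"
  shows "frontier (f ` S) = f ` frontier S"
  using assms by (simp add: frontier_def interior_injective_linear_image
      closure_injective_linear_image[symmetric] image_set_diff)

lemma subdivision_image:
  assumes "tile_substitution Q A D"
  shows "\<exists>P. subdivision A (Q ` A j) P"
proof
  \<comment> \<open>Digits of empty prototiles are dropped; they add nothing to the union.\<close>
  define P where "P = {p. fst p \<in> D (snd p) j \<and> A (snd p) \<noteq> {}}"
  have "P \<subseteq> (\<Union>i. (\<lambda>u. (u, i)) ` D i j)"
    by (force simp: P_def)
  moreover have "finite (\<Union>i. (\<lambda>u. (u, i)) ` D i j)"
    using assms by (simp add: tile_substitution_def)
  ultimately have fin: "finite P"
    by (rule finite_subset)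
  have "Q ` A j = (\<Union>i. \<Union>u\<in>D i j. (+) u ` A i)"
    using assms by (simp add: tile_substitution_def)
  also have "\<dots> = \<Union>(placed A ` P)"
    by (force simp: P_def placed_def)
  finally have union: "Q ` A j = \<Union>(placed A ` P)" .
  have disj: "\<forall>j i i'. \<forall>u\<in>D i j. \<forall>u'\<in>D i' j. (i, u) \<noteq> (i', u') \<longrightarrow>
        interior ((+) u ` A i) \<inter> interior ((+) u' ` A i') = {}"
    using assms by (simp add: tile_substitution_def)
  have "disjoint_family_on (\<lambda>p. interior (placed A p)) P"
    unfolding disjoint_family_on_def
  proof (intro ballI impI)
    fix p q assume "p \<in> P" "q \<in> P" "p \<noteq> q"
    then show "interior (placed A p) \<inter> interior (placed A q) = {}"
      unfolding placed_def P_def by (intro disj[rule_format]) (auto simp: prod_eq_iff)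
  qed
  with fin union show "subdivision A (Q ` A j) P"
    by (auto simp: subdivision_def P_def)
qed

text \<open>Each piece is inflated and subdivided again. Children of one parent have disjoint
  interiors by the substitution rule; those of different parents have interiors inside the
  \<open>Q\<close>-images of the parents' interiors, which are disjoint because \<open>Q\<close> is
  injective.\<close>

lemma subdivision_funpow:
  assumes sub: "tile_substitution Q A D" and inj: "inj Q" and "A j \<noteq> {}"
  shows "\<exists>P. subdivision A ((Q ^^ n) ` A j) P"
proof (induction n)
  case 0
  have "subdivision A ((Q ^^ 0) ` A j) {(0, j)}"
    using assms(3) by (simp add: subdivision_def placed_def disjoint_family_on_def)
  then show ?case by blast
next
  case (Suc n)
  have Q: "linear Q"
    using sub by (simp add: tile_substitution_def expansive_def)
  obtain P where P: "subdivision A ((Q ^^ n) ` A j) P"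
    using Suc by blast
  obtain E where E: "\<And>i. subdivision A (Q ` A i) (E i)"
    using subdivision_image[OF sub] by metis
  have P_fin: "finite P" and P_union: "(Q ^^ n) ` A j = \<Union>(placed A ` P)"
    and P_disj: "disjoint_family_on (\<lambda>p. interior (placed A p)) P"
    using P unfolding subdivision_def by blast+
  have E_fin: "finite (E i)" and E_union: "Q ` A i = \<Union>(placed A ` E i)"
    and E_ne: "\<forall>e\<in>E i. A (snd e) \<noteq> {}"
    and E_disj: "disjoint_family_on (\<lambda>e. interior (placed A e)) (E i)" for i
    using E[of i] unfolding subdivision_def by blast+
  \<comment> \<open>\<open>Q\<close> sends \<open>u + A i\<close> to \<open>Q u\<close> plus the
    image of \<open>A i\<close>, so the digits are shifted by \<open>Q u\<close>.\<close>
  define child where "child p = (\<lambda>e. (Q (fst p) + fst e, snd e)) ` E (snd p)" for p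
  define P' where "P' = \<Union>(child ` P)"
  have child_union: "\<Union>(placed A ` child p) = Q ` placed A p" for p
  proof -
    have "\<Union>(placed A ` child p) = (+) (Q (fst p)) ` \<Union>(placed A ` E (snd p))"
      by (simp add: child_def placed_shift[symmetric] image_Union image_image)
    also have "\<Union>(placed A ` E (snd p)) = Q ` A (snd p)"
      using E_union by simp
    finally show ?thesis
      by (simp add: placed_def linear_image_translation[OF Q])
  qed
  have same: "interior (placed A x) \<inter> interior (placed A y) = {}"
    if xy: "x \<in> child p" "y \<in> child p" "x \<noteq> y" for x y p
  proof -
    obtain e f where ef: "e \<in> E (snd p)" "f \<in> E (snd p)"
      "x = (Q (fst p) + fst e, snd e)" "y = (Q (fst p) + fst f, snd f)"
      using xy(1,2) unfolding child_def by blast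
    moreover from this have "e \<noteq> f" using xy(3) by auto
    ultimately have "interior (placed A e) \<inter> interior (placed A f) = {}"
      using E_disj[of "snd p"] unfolding disjoint_family_on_def by blast
    then show ?thesis
      unfolding ef(3,4) placed_shift[symmetric] interior_translation
      by auto
  qed
  have parent: "interior (placed A x) \<subseteq> Q ` interior (placed A p)" if "x \<in> child p" for x p
    using interior_mono[of "placed A x" "Q ` placed A p"] child_union[of p] that
    by (auto simp: interior_injective_linear_image[OF Q inj])
  have "interior (placed A x) \<inter> interior (placed A y) = {}"
    if xy: "x \<in> P'" "y \<in> P'" "x \<noteq> y" for x y
  proof -
    obtain p q where pq: "p \<in> P" "q \<in> P" "x \<in> child p" "y \<in> child q"
      using xy by (auto simp: P'_def)
    show ?thesis
    proof (cases "p = q")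
      case True
      then show ?thesis using same pq xy by blast
    next
      case False
      then have "interior (placed A p) \<inter> interior (placed A q) = {}"
        using P_disj pq(1,2) unfolding disjoint_family_on_def by blast
      then have "Q ` interior (placed A p) \<inter> Q ` interior (placed A q) = {}"
        using inj by (simp add: image_Int[symmetric])
      then show ?thesis
        using parent[OF pq(3)] parent[OF pq(4)] by blast
    qed
  qed
  moreover have "finite P'"
    using P_fin E_fin by (simp add: P'_def child_def)
  moreover have "\<forall>p\<in>P'. A (snd p) \<noteq> {}"
    using E_ne by (auto simp: P'_def child_def)
  moreover have "(Q ^^ Suc n) ` A j = \<Union>(placed A ` P')"
  proof -
    have "(Q ^^ Suc n) ` A j = Q ` \<Union>(placed A ` P)"
      by (simp only: P_union[symmetric] funpow.simps image_comp)
    also have "\<dots> = (\<Union>p\<in>P. \<Union>(placed A ` child p))"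
      by (simp add: child_union image_Union image_image)
    finally show ?thesis by (simp add: P'_def)
  qed
  ultimately have "subdivision A ((Q ^^ Suc n) ` A j) P'"
    by (simp add: subdivision_def disjoint_family_on_def)
  then show ?case by blast
qed

text \<open>The interiors of the pieces are disjoint subsets of the inflated interior. Boundaries of
  pieces are left out of the sum, hence an inequality.\<close>

lemma subdivision_measure_le:
  fixes A :: "'m \<Rightarrow> (real ^ 'd::finite) set"
  assumes "subdivision A (R ` A j) P" "linear R" "inj R" "\<And>i. bounded (A i)"
  shows "(\<Sum>p\<in>P. measure lebesgue (interior (A (snd p))))
    \<le> \<bar>det (matrix R)\<bar> * measure lebesgue (interior (A j))"
proof -
  have meas: "interior (placed A p) \<in> lmeasurable" for p
    using assms(4) by (intro lmeasurable_interior) (simp add: placed_def bounded_translation)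
  have measR: "R ` interior (A j) \<in> lmeasurable"
    using measure_linear_image_finite[OF assms(2) lmeasurable_interior] assms(4) by blast
  have "(\<Sum>p\<in>P. measure lebesgue (interior (A (snd p)))) = (\<Sum>p\<in>P. measure lebesgue (interior (placed A p)))"
    by (simp add: interior_placed measure_translation)
  also have "\<dots> = measure lebesgue (\<Union>p\<in>P. interior (placed A p))"
    using assms(1) fmeasurableD[OF meas] fmeasurableD2[OF meas]
    by (intro measure_finite_Union[symmetric]) (auto simp only: subdivision_def infinity_ennreal_def)
  also have "\<dots> \<le> measure lebesgue (R ` interior (A j))"
  proof (rule measure_mono_fmeasurable)
    have "interior (placed A p) \<subseteq> interior (R ` A j)" if "p \<in> P" for p
      using that assms(1) by (intro interior_mono) (auto simp: subdivision_def)
    then show "(\<Union>p\<in>P. interior (placed A p)) \<subseteq> R ` interior (A j)"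
      using assms by (auto simp: interior_injective_linear_image)
    show "(\<Union>p\<in>P. interior (placed A p)) \<in> sets lebesgue"
      by (intro sets_completionI_sets) (simp add: borel_open open_UN)
  qed (fact measR)
  also have "\<dots> = \<bar>det (matrix R)\<bar> * measure lebesgue (interior (A j))"
    using measure_linear_image_finite[OF assms(2) lmeasurable_interior] assms(4) by blast
  finally show ?thesis .
qed

lemma compact_family_in_ball:
  fixes A :: "'m::finite \<Rightarrow> 'a::euclidean_space set"
  assumes "\<And>i. compact (A i)"
  obtains b where "\<And>i. A i \<subseteq> ball 0 b"
proof -
  have "bounded (\<Union>i. A i)"
    using assms by (intro bounded_UN) (auto intro: compact_imp_bounded)
  then show thesis
    using bounded_subset_ballD that by (metis UN_subset_iff UNIV_I)
qed

text \<open>Let \<open>x\<close> be the centre of a ball inside \<open>A j\<close>. The piece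
  containing the image of \<open>x\<close> has bounded \<open>w\<close>-diameter, and pulling back
  by \<open>Q ^^ n\<close> divides \<open>w\<close> by \<open>dilation Q ^ n\<close>; for large
  \<open>n\<close> its preimage lies in the ball.\<close>

lemma eventually_subdivision_interior_piece:
  fixes A :: "'m::finite \<Rightarrow> (real ^ 'd::finite) set"
  assumes sub: "tile_substitution Q A D" and w: "pseudo_norm Q w" and "inj Q" "A j \<noteq> {}"
  shows "\<forall>\<^sub>F n in sequentially. \<forall>P. subdivision A ((Q ^^ n) ` A j) P \<longrightarrow>
    (\<exists>p\<in>P. placed A p \<subseteq> interior ((Q ^^ n) ` A j))"
proof -
  have exp: "expansive Q" and tile: "\<And>i. compact (A i)" "\<And>i. A i = closure (interior (A i))"
    using sub by (auto simp: tile_substitution_def is_tile_def)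
  then have Q: "linear Q" by (simp add: expansive_def)
  have "interior (A j) \<noteq> {}"
    using tile(2)[of j] assms(4) by auto
  then obtain x r where x: "0 < r" "ball x r \<subseteq> interior (A j)"
    by (metis all_not_in_conv open_contains_ball open_interior)
  obtain \<epsilon> where \<epsilon>: "0 < \<epsilon>" "\<And>y. w y < \<epsilon> \<Longrightarrow> norm y < r"
    using pseudo_norm_small_imp_norm_small[OF w x(1)] by blast
  obtain b where b: "\<And>i. A i \<subseteq> ball 0 b"
    using compact_family_in_ball[of A] tile(1) by blast
  \<comment> \<open>Two points of a translated prototile differ by less than \<open>2 * b\<close>,
    so \<open>K\<close> serves for all \<open>n\<close> and \<open>P\<close>.\<close>
  obtain K where K: "\<And>y. norm y \<le> 2 * b \<Longrightarrow> w y \<le> K"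
    using pseudo_norm_bounded_on_cball[OF w] by blast
  have "(\<lambda>n. K * inverse (dilation Q) ^ n) \<longlonglongrightarrow> K * 0"
    using dilation_gt_1[OF exp w]
    by (intro tendsto_intros LIMSEQ_realpow_zero) (auto simp: inverse_less_1_iff)
  then have "\<forall>\<^sub>F n in sequentially. K * inverse (dilation Q) ^ n < \<epsilon>"
    using \<epsilon>(1) by (intro order_tendstoD(2)) simp_all
  then show ?thesis
  proof eventually_elim
    case (elim n)
    define R where "R = Q ^^ n"
    have R: "linear R" "inj R"
      using Q \<open>inj Q\<close> by (simp_all add: R_def linear_funpow inj_fn)
    then have surj: "surj R"
      using linear_injective_imp_surjective by blast
    have K_less: "K < dilation Q ^ n * \<epsilon>"
      using elim dilation_gt_1[OF exp w] by (simp add: field_simps)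
    have "\<exists>p\<in>P. placed A p \<subseteq> interior (R ` A j)" if P: "subdivision A (R ` A j) P" for P
    proof -
      have "x \<in> A j"
        using x interior_subset[of "A j"] by (meson centre_in_ball subsetD)
      then obtain p where p: "p \<in> P" "R x \<in> placed A p"
        using P unfolding subdivision_def by blast
      have "y \<in> R ` interior (A j)" if y: "y \<in> placed A p" for y
      proof -
        obtain z where z: "y = R z" using surj by blast
        obtain a c where "a \<in> A (snd p)" "c \<in> A (snd p)" "y = fst p + a" "R x = fst p + c"
          using y p(2) unfolding placed_def by blast
        then have "R z - R x = a - c" "norm a < b" "norm c < b"
          using z b[of "snd p"] by auto
        then have "w (R z - R x) \<le> K"
          using norm_triangle_ineq4[of a c] by (intro K) auto
        then have "dilation Q ^ n * w (z - x) \<le> K"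
          using pseudo_norm_funpow[OF w, of n "z - x"] linear_diff[OF R(1)] by (simp add: R_def)
        then have "dilation Q ^ n * w (z - x) < dilation Q ^ n * \<epsilon>"
          using K_less by linarith
        then have "w (z - x) < \<epsilon>"
          using dilation_gt_1[OF exp w] by (simp add: mult_less_cancel_left)
        then have "z \<in> ball x r"
          using \<epsilon>(2)[of "z - x"] by (simp add: dist_norm norm_minus_commute)
        then show ?thesis using x z by blast
      qed
      then show ?thesis
        using p(1) interior_injective_linear_image[OF R] by blast
    qed
    then show ?case by (simp add: R_def)
  qed
qed

section \<open>Covering the boundary\<close>

lemma measure_interior_pos:
  fixes S :: "'a::euclidean_space set"
  assumes "compact S" "S = closure (interior S)" "S \<noteq> {}"
  shows "0 < measure lebesgue (interior S)"
proof -
  have "interior S \<noteq> {}"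
    using assms(2,3) by auto
  then have "\<not> negligible (interior S)"
    using open_not_negligible by blast
  moreover have "interior S \<in> lmeasurable"
    using assms(1) by (intro lmeasurable_interior compact_imp_bounded)
  ultimately show ?thesis
    by (metis negligible_iff_measure measure_nonneg order_le_less)
qed

text \<open>A boundary point of \<open>S\<close> lies in some piece, but not in its interior, which
  is contained in that of \<open>S\<close>. That piece cannot be \<open>p\<close>, which avoids the
  boundary altogether.\<close>

lemma frontier_subset_of_interior_piece:
  fixes A :: "'m \<Rightarrow> (real ^ 'd::finite) set"
  assumes "subdivision A S P" "closed S" "\<And>i. closed (A i)" "placed A p \<subseteq> interior S"
  shows "frontier S \<subseteq> (\<Union>q\<in>P - {p}. (+) (fst q) ` frontier (A (snd q)))"
proof
  fix x assume "x \<in> frontier S"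
  then have x: "x \<in> S" "x \<notin> interior S"
    using assms(2) by (auto simp: frontier_def)
  then obtain q where q: "q \<in> P" "x \<in> placed A q"
    using assms(1) by (auto simp: subdivision_def)
  then have "interior (placed A q) \<subseteq> interior S"
    using assms(1) by (intro interior_mono) (auto simp: subdivision_def)
  with x q have "x \<in> frontier (placed A q)"
    using closure_subset by (fastforce simp: frontier_def)
  then have "x \<in> (+) (fst q) ` frontier (A (snd q))"
    by (simp add: placed_def frontier_translation)
  moreover have "q \<noteq> p"
    using q x assms(4) by blast
  ultimately show "x \<in> (\<Union>q\<in>P - {p}. (+) (fst q) ` frontier (A (snd q)))"
    using q(1) by blast
qed

text \<open>Only boundaries cover \<open>X\<close>, so that each can be covered again after
  inflation. The volume bound \<open>c\<close> stands in for a bound on the number of tiles.\<close>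

definition frontier_cover ::
    "('m \<Rightarrow> (real ^ 'd::finite) set) \<Rightarrow> (real ^ 'd) set \<Rightarrow> real \<Rightarrow> ((real ^ 'd) \<times> 'm) set \<Rightarrow> bool" where
  "frontier_cover A X c B \<longleftrightarrow>
     finite B \<and> (\<forall>p\<in>B. A (snd p) \<noteq> {}) \<and>
     X \<subseteq> (\<Union>p\<in>B. (+) (fst p) ` frontier (A (snd p))) \<and>
     (\<Sum>p\<in>B. measure lebesgue (interior (A (snd p)))) \<le> c"

text \<open>Dropping a piece that lies in the interior of the inflated tile saves a fixed proportion of
  the volume.\<close>

lemma frontier_contraction:
  fixes A :: "'m::finite \<Rightarrow> (real ^ 'd::finite) set"
  assumes sub: "tile_substitution Q A D" and w: "pseudo_norm Q w" and inj: "inj Q"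
  obtains N \<rho> where "1 \<le> N" "0 \<le> \<rho>" "\<rho> < \<bar>det (matrix Q)\<bar> ^ N"
    "\<And>j. \<exists>B. frontier_cover A ((Q ^^ N) ` frontier (A j)) (\<rho> * measure lebesgue (interior (A j))) B"
proof -
  define v where "v i = measure lebesgue (interior (A i))" for i
  have exp: "expansive Q" and tile: "\<And>i. compact (A i)" "\<And>i. A i = closure (interior (A i))"
    using sub by (auto simp: tile_substitution_def is_tile_def)
  then have Q: "linear Q" by (simp add: expansive_def)
  have v_pos: "0 < v i" if "A i \<noteq> {}" for i
    unfolding v_def using tile that by (rule measure_interior_pos)
  \<comment> \<open>The least volume of a nonempty prototile, capped at 1; the inserted 1 keeps
    \<open>Min\<close> meaningful.\<close>
  define c where "c = Min (insert 1 (v ` {i. A i \<noteq> {}}))"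
  have c: "0 < c" "\<And>i. A i \<noteq> {} \<Longrightarrow> c \<le> v i"
    using v_pos by (auto simp: c_def)
  \<comment> \<open>The inserted 1 makes \<open>V\<close> positive even if all prototiles are
    empty.\<close>
  define V where "V = Max (insert 1 (range v))"
  have V: "0 < V" "\<And>i. v i \<le> V"
    unfolding V_def by (auto simp: Max_gr_iff intro!: Max_ge simp del: Max_insert)
  have "\<forall>\<^sub>F n in sequentially. A j \<noteq> {} \<longrightarrow> (\<forall>P. subdivision A ((Q ^^ n) ` A j) P \<longrightarrow>
    (\<exists>p\<in>P. placed A p \<subseteq> interior ((Q ^^ n) ` A j)))" for j
    using eventually_subdivision_interior_piece[OF sub w inj, of j] by (cases "A j = {}") simp_all
  then have "\<forall>\<^sub>F n in sequentially. \<forall>j. A j \<noteq> {} \<longrightarrow> (\<forall>P. subdivision A ((Q ^^ n) ` A j) P \<longrightarrow>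
    (\<exists>p\<in>P. placed A p \<subseteq> interior ((Q ^^ n) ` A j)))"
    by (rule eventually_all_finite)
  \<comment> \<open>One \<open>N\<close> serves all of the finitely many colours;
    \<open>1 \<le> N\<close> will later make \<open>\<kappa>\<close> strictly less than 1.\<close>
  from eventually_happens'[OF sequentially_bot eventually_conj[OF this eventually_ge_at_top[of 1]]]
  obtain N where N: "1 \<le> N"
    "\<And>j P. A j \<noteq> {} \<Longrightarrow> subdivision A ((Q ^^ N) ` A j) P \<Longrightarrow>
      \<exists>p\<in>P. placed A p \<subseteq> interior ((Q ^^ N) ` A j)"
    by blast
  define R where "R = Q ^^ N"
  have R: "linear R" "inj R"
    using Q inj by (simp_all add: R_def linear_funpow inj_fn)
  define \<Lambda> where "\<Lambda> = \<bar>det (matrix Q)\<bar> ^ N"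
  have \<Lambda>: "0 < \<Lambda>" "\<bar>det (matrix R)\<bar> = \<Lambda>"
    using det_nz_iff_inj[OF Q] inj by (simp_all add: \<Lambda>_def R_def det_matrix_funpow[OF Q] power_abs)
  \<comment> \<open>The dropped piece has volume at least \<open>c\<close>, and
    \<open>c \<ge> c / V * v j\<close> for every \<open>j\<close>. The maximum with 0 allows volume
    bounds to be multiplied by \<open>\<rho>\<close>.\<close>
  define \<rho> where "\<rho> = max 0 (\<Lambda> - c / V)"
  have "\<exists>B. frontier_cover A (R ` frontier (A j)) (\<rho> * v j) B" for j
  proof (cases "A j = {}")
    case True
    then show ?thesis
      by (intro exI[of _ "{}"]) (simp add: frontier_cover_def v_def)
  next
    case False
    obtain P where P: "subdivision A (R ` A j) P"
      unfolding R_def using subdivision_funpow[OF sub inj False] by blast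
    then obtain p where p: "p \<in> P" "placed A p \<subseteq> interior (R ` A j)"
      using N(2)[OF False] unfolding R_def by blast
    have P': "finite P" "\<And>p. p \<in> P \<Longrightarrow> A (snd p) \<noteq> {}"
      using P by (auto simp: subdivision_def)
    have "closed (R ` A j)"
      using tile(1) R by (intro closed_injective_linear_image compact_imp_closed)
    then have "frontier (R ` A j) \<subseteq> (\<Union>q\<in>P - {p}. (+) (fst q) ` frontier (A (snd q)))"
      using frontier_subset_of_interior_piece[OF P _ _ p(2)] tile(1) compact_imp_closed by blast
    moreover have "(\<Sum>q\<in>P - {p}. v (snd q)) \<le> \<rho> * v j"
    proof -
      have "(\<Sum>q\<in>P - {p}. v (snd q)) = (\<Sum>q\<in>P. v (snd q)) - v (snd p)"
        using P'(1) p(1) by (simp add: sum_diff1)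
      also have "(\<Sum>q\<in>P. v (snd q)) \<le> \<Lambda> * v j"
        using subdivision_measure_le[OF P R] tile(1) \<Lambda>(2) by (simp add: v_def compact_imp_bounded)
      also have "\<Lambda> * v j - v (snd p) \<le> (\<Lambda> - c / V) * v j"
      proof -
        have "c / V * v j \<le> c"
          using V(2)[of j] V(1) c(1) by (simp add: field_simps)
        then show ?thesis
          using c(2)[OF P'(2)[OF p(1)]] by (simp add: algebra_simps)
      qed
      also have "\<dots> \<le> \<rho> * v j"
        using v_pos[OF False] by (intro mult_right_mono) (auto simp: \<rho>_def)
      finally show ?thesis by simp
    qed
    ultimately have "frontier_cover A (R ` frontier (A j)) (\<rho> * v j) (P - {p})"
      using P' by (simp add: frontier_cover_def frontier_injective_linear_image[OF R] v_def)
    then show ?thesis by blast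
  qed
  moreover have "0 \<le> \<rho>" "\<rho> < \<Lambda>"
    using \<Lambda> c(1) V(1) by (auto simp: \<rho>_def)
  ultimately show thesis
    using that[OF N(1), of \<rho>] by (simp add: R_def \<Lambda>_def v_def)
qed

text \<open>Every boundary in the cover at stage \<open>n\<close> is inflated and replaced by its
  own cover, so each stage multiplies the volume bound by \<open>\<rho>\<close>.\<close>

lemma frontier_cover_funpow:
  fixes A :: "'m \<Rightarrow> (real ^ 'd::finite) set"
  assumes R: "linear R" and \<rho>: "0 \<le> \<rho>"
    and step: "\<And>j. \<exists>B. frontier_cover A (R ` frontier (A j)) (\<rho> * measure lebesgue (interior (A j))) B"
  shows "\<exists>B. frontier_cover A ((R ^^ n) ` frontier (A j)) (\<rho> ^ n * measure lebesgue (interior (A j))) B"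
proof (induction n)
  case 0
  show ?case
    \<comment> \<open>At stage 0 the boundary covers itself; an empty prototile gets the empty
      cover, as \<open>frontier_cover\<close> admits no empty tiles.\<close>
    by (intro exI[of _ "if A j = {} then {} else {(0, j)}"]) (simp add: frontier_cover_def)
next
  case (Suc n)
  define v where "v i = measure lebesgue (interior (A i))" for i
  obtain B where B: "frontier_cover A ((R ^^ n) ` frontier (A j)) (\<rho> ^ n * v j) B"
    using Suc unfolding v_def by blast
  obtain E where E: "\<And>i. frontier_cover A (R ` frontier (A i)) (\<rho> * v i) (E i)"
    using step unfolding v_def by metis
  have fin: "finite B" "\<And>i. finite (E i)"
    using B E by (auto simp: frontier_cover_def)
  define child where "child = (\<lambda>(p :: (real ^ 'd) \<times> 'm, e :: (real ^ 'd) \<times> 'm). (R (fst p) + fst e, snd e))"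
  define I where "I = (SIGMA p:B. E (snd p))"
  have "(R ^^ Suc n) ` frontier (A j) \<subseteq> (\<Union>p\<in>B. R ` (+) (fst p) ` frontier (A (snd p)))"
    using B unfolding frontier_cover_def funpow.simps image_comp[symmetric] by blast
  also have "\<dots> = (\<Union>p\<in>B. (+) (R (fst p)) ` R ` frontier (A (snd p)))"
    by (simp add: linear_image_translation[OF R])
  also have "\<dots> \<subseteq> (\<Union>p\<in>B. (+) (R (fst p)) ` (\<Union>e\<in>E (snd p). (+) (fst e) ` frontier (A (snd e))))"
    using E unfolding frontier_cover_def by (intro UN_mono image_mono) auto
  also have "\<dots> = (\<Union>q\<in>child ` I. (+) (fst q) ` frontier (A (snd q)))"
    by (force simp: I_def child_def image_UN image_image add.assoc)
  finally have cover: "(R ^^ Suc n) ` frontier (A j) \<subseteq> \<dots>" .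
  \<comment> \<open>Different parents may produce the same child, so the sum over the image is only
    bounded by the sum over \<open>I\<close>.\<close>
  have "(\<Sum>q\<in>child ` I. v (snd q)) \<le> (\<Sum>i\<in>I. v (snd (child i)))"
    using sum_image_le[of I "\<lambda>q. v (snd q)" child] fin by (simp add: I_def v_def o_def)
  also have "\<dots> = (\<Sum>p\<in>B. \<Sum>e\<in>E (snd p). v (snd e))"
    using fin by (simp add: I_def sum.Sigma child_def case_prod_beta)
  also have "\<dots> \<le> (\<Sum>p\<in>B. \<rho> * v (snd p))"
    using E by (intro sum_mono) (simp add: frontier_cover_def v_def)
  also have "\<dots> = \<rho> * (\<Sum>p\<in>B. v (snd p))"
    by (simp add: sum_distrib_left)
  also have "\<dots> \<le> \<rho> * (\<rho> ^ n * v j)"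
    using B \<rho> by (intro mult_left_mono) (simp_all add: frontier_cover_def v_def)
  finally have "(\<Sum>q\<in>child ` I. v (snd q)) \<le> \<rho> ^ Suc n * v j"
    by (simp add: mult.assoc)
  moreover have "finite (child ` I)"
    using fin by (simp add: I_def)
  moreover have "\<forall>q\<in>child ` I. A (snd q) \<noteq> {}"
    using E by (auto simp: I_def child_def frontier_cover_def)
  ultimately have "frontier_cover A ((R ^^ Suc n) ` frontier (A j)) (\<rho> ^ Suc n * v j) (child ` I)"
    using cover by (simp add: frontier_cover_def v_def)
  then show ?case
    unfolding v_def by blast
qed

text \<open>A volume factor \<open>\<rho>\<close> below
  \<open>\<bar>det (matrix Q)\<bar> ^ N\<close> says exactly that
  \<open>\<rho> * \<kappa> powr d < 1\<close>, where \<open>\<kappa>\<close> is the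
  \<open>w\<close>-contraction of the inverse of \<open>Q ^^ N\<close> and \<open>d\<close> the
  dimension. This leaves an exponent \<open>s < d\<close> for
  \<open>hausdorff_measure_w_eq_0\<close>.\<close>

lemma hausdorff_dim_w_frontier_prototile:
  fixes Q :: "real ^ 'd \<Rightarrow> real ^ 'd::finite" and A :: "'m::finite \<Rightarrow> (real ^ 'd) set"
  assumes sub: "tile_substitution Q A D" and w: "pseudo_norm Q w"
  shows "hausdorff_dim_w w ((+) x ` frontier (A j)) < of_nat CARD('d)"
proof -
  define v where "v i = measure lebesgue (interior (A i))" for i
  have exp: "expansive Q" and tile: "\<And>i. compact (A i)" "\<And>i. A i = closure (interior (A i))"
    using sub by (auto simp: tile_substitution_def is_tile_def)
  then have Q: "linear Q" by (simp add: expansive_def)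
  have dil: "1 < dilation Q"
    using dilation_gt_1[OF exp w] .
  \<comment> \<open>A zero determinant would make \<open>dilation Q\<close> zero.\<close>
  then have "det (matrix Q) \<noteq> 0"
    using dilation_power_card[of Q] by auto
  then have inj: "inj Q"
    using det_nz_iff_inj[OF Q] by simp
  obtain N \<rho> where N: "1 \<le> N" and \<rho>: "0 \<le> \<rho>" "\<rho> < \<bar>det (matrix Q)\<bar> ^ N"
    and contr: "\<And>j. \<exists>B. frontier_cover A ((Q ^^ N) ` frontier (A j)) (\<rho> * measure lebesgue (interior (A j))) B"
    using frontier_contraction[OF sub w inj] by metis
  define R where "R = Q ^^ N"
  have R: "linear R"
    using Q by (simp add: R_def linear_funpow)
  define \<kappa> where "\<kappa> = inverse (dilation Q ^ N)"
  have \<kappa>: "0 < \<kappa>" "\<kappa> < 1"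
    using dil N by (auto simp: \<kappa>_def one_less_power intro!: inverse_less_1_iff[THEN iffD2])
  have wR: "w y = \<kappa> ^ n * w ((R ^^ n) y)" for n y
    using dil unfolding R_def funpow_mult pseudo_norm_funpow[OF w] \<kappa>_def
    by (simp add: power_mult[symmetric] power_inverse)
  have "\<kappa> powr real CARD('d) = inverse (\<bar>det (matrix Q)\<bar> ^ N)"
    using \<kappa>(1) by (simp add: powr_realpow \<kappa>_def power_inverse power_mult[symmetric]
        dilation_power_card[symmetric] mult.commute)
  moreover have "\<rho> * inverse (\<bar>det (matrix Q)\<bar> ^ N) < 1"
    using \<rho> by (simp add: divide_inverse[symmetric] divide_less_eq)
  ultimately have "\<rho> * \<kappa> powr real CARD('d) < 1"
    by simp
  \<comment> \<open>The inequality is strict at the full dimension, so by continuity in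
    \<open>s\<close> it persists slightly below.\<close>
  moreover have "((\<lambda>s. \<rho> * \<kappa> powr s) \<longlongrightarrow> \<rho> * \<kappa> powr real CARD('d)) (at_left (real CARD('d)))"
    using \<kappa>(1) by (intro tendsto_intros) auto
  ultimately have "\<forall>\<^sub>F s in at_left (real CARD('d)). \<rho> * \<kappa> powr s < 1"
    by (rule order_tendstoD(2)[rotated])
  moreover have "\<forall>\<^sub>F s in at_left (real CARD('d)). s \<in> {0<..<real CARD('d)}"
    by (intro eventually_at_left_real) simp
  ultimately have "\<forall>\<^sub>F s in at_left (real CARD('d)). \<rho> * \<kappa> powr s < 1 \<and> s \<in> {0<..<real CARD('d)}"
    by (rule eventually_conj)
  then obtain s where s: "\<rho> * \<kappa> powr s < 1" "0 < s" "s < real CARD('d)"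
    by (auto dest!: eventually_happens'[rotated])
  obtain b where b: "\<And>i. A i \<subseteq> ball 0 b"
    using compact_family_in_ball[of A] tile(1) by blast
  obtain K where K: "0 < K" "\<And>y. norm y \<le> 2 * b \<Longrightarrow> w y \<le> K"
    using pseudo_norm_bounded_on_cball[OF w] by blast
  have v_pos: "0 < v i" if "A i \<noteq> {}" for i
    unfolding v_def using tile that by (rule measure_interior_pos)
  define c where "c = Min (insert 1 (v ` {i. A i \<noteq> {}}))"
  have c: "0 < c" "\<And>i. A i \<noteq> {} \<Longrightarrow> c \<le> v i"
    using v_pos by (auto simp: c_def)
  have "hausdorff_measure_w w s ((+) x ` frontier (A j)) = 0"
  proof (rule hausdorff_measure_w_eq_0[OF s(2) K(1) \<kappa> \<rho>(1) s(1)])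
    fix n
    obtain B where B: "frontier_cover A ((R ^^ n) ` frontier (A j)) (\<rho> ^ n * v j) B"
      using frontier_cover_funpow[OF R \<rho>(1) contr[folded R_def]] unfolding v_def by blast
    \<comment> \<open>Covers must be open, so each boundary is enlarged to the ball of radius
      \<open>b\<close> around its translation vector before it is pulled back by
      \<open>R ^^ n\<close> and shifted by \<open>x\<close>.\<close>
    define U where "U p = (+) x ` ((R ^^ n) -` (+) (fst p) ` ball 0 b)" for p :: "(real ^ 'd) \<times> 'm"
    \<comment> \<open>Each covering tile has interior volume at least \<open>c\<close>, which turns
      the volume bound into a count.\<close>
    have "real (card B) * c \<le> (\<Sum>p\<in>B. v (snd p))"
      using B c(2) unfolding frontier_cover_def by (intro sum_bounded_below) blast
    also have "\<dots> \<le> \<rho> ^ n * v j"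
      using B by (simp add: frontier_cover_def v_def)
    finally have "real (card B) \<le> v j / c * \<rho> ^ n"
      using c(1) by (simp add: field_simps)
    moreover have "card (U ` B) \<le> card B"
      using B by (intro card_image_le) (simp add: frontier_cover_def)
    ultimately have card: "real (card (U ` B)) \<le> v j / c * \<rho> ^ n"
      by linarith
    have "open (U p)" for p
    proof -
      have "continuous_on UNIV (R ^^ n)"
        using linear_funpow[OF R] by (simp add: linear_continuous_on linear_linear)
      then show ?thesis
        unfolding U_def by (intro open_translation open_vimage) auto
    qed
    moreover have "diam_w w (U p) \<le> ennreal (K * \<kappa> ^ n)" for p
      unfolding diam_w_def
    proof (intro SUP_least ennreal_leI)
      have U_mem: "\<exists>y' a. y = x + y' \<and> (R ^^ n) y' = fst p + a \<and> norm a < b" if y: "y \<in> U p" for y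
      proof -
        obtain y' a where "y = x + y'" "(R ^^ n) y' = fst p + a" "a \<in> ball 0 b"
          using y unfolding U_def by blast
        then show ?thesis by auto
      qed
      fix y z assume "y \<in> U p" "z \<in> U p"
      then obtain y' z' a a' where yz: "y = x + y'" "z = x + z'"
        "(R ^^ n) y' = fst p + a" "(R ^^ n) z' = fst p + a'" "norm a < b" "norm a' < b"
        using U_mem by metis
      have "w (y - z) = \<kappa> ^ n * w ((R ^^ n) (y' - z'))"
        using wR[of "y' - z'" n] yz(1,2) by simp
      also have "(R ^^ n) (y' - z') = a - a'"
        using linear_diff[OF linear_funpow[OF R]] yz(3,4) by simp
      also have "\<kappa> ^ n * w (a - a') \<le> \<kappa> ^ n * K"
        using yz(5,6) \<kappa>(1) norm_triangle_ineq4[of a a'] by (intro mult_left_mono K(2)) auto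
      finally show "w (y - z) \<le> K * \<kappa> ^ n"
        by (simp add: mult.commute)
    qed
    moreover have "(+) x ` frontier (A j) \<subseteq> \<Union>(U ` B)"
    proof clarify
      fix y assume "y \<in> frontier (A j)"
      then obtain p where p: "p \<in> B" "(R ^^ n) y \<in> (+) (fst p) ` frontier (A (snd p))"
        using B unfolding frontier_cover_def by blast
      moreover have "frontier (A i) \<subseteq> ball 0 b" for i
        using b[of i] frontier_subset_compact[OF tile(1)] by blast
      ultimately have "x + y \<in> U p"
        unfolding U_def by blast
      then show "x + y \<in> \<Union>(U ` B)"
        using p(1) by blast
    qed
    moreover have "finite (U ` B)"
      using B by (simp add: frontier_cover_def)
    ultimately show "\<exists>F. finite F \<and> real (card F) \<le> v j / c * \<rho> ^ n \<and> (+) x ` frontier (A j) \<subseteq> \<Union>F \<and>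
        (\<forall>U\<in>F. open U \<and> diam_w w U \<le> ennreal (K * \<kappa> ^ n))"
      using card by blast
  qed
  then have "hausdorff_dim_w w ((+) x ` frontier (A j)) \<le> ennreal s"
    unfolding hausdorff_dim_w_def using s(2) by (intro Inf_lower) blast
  also have "\<dots> < of_nat CARD('d)"
    using s by (simp add: ennreal_of_nat_eq_real_of_nat ennreal_less_iff)
  finally show ?thesis .
qed

theorem theorem4p5:
  fixes Q :: "real ^ 'd \<Rightarrow> real ^ 'd::finite"
    and w :: "real ^ 'd \<Rightarrow> real"
    and \<T> :: "('d, 'm::finite) tile set"
  assumes "self_affine_tiling Q \<T>"
    and "pseudo_norm Q w"
    and "(A, i) \<in> \<T>"
  shows "hausdorff_dim_w w (frontier A) < of_nat CARD('d)"
proof -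
  obtain P D where sub: "tile_substitution Q P D"
    and tiles: "\<forall>T\<in>\<T>. \<exists>x j. T = translate_tile x (P j, j)"
    using assms(1) by (auto simp: self_affine_tiling_def)
  \<comment> \<open>Every tile is a translate of a prototile, and its boundary is translated with
    it.\<close>
  then obtain x j where A: "A = (+) x ` P j"
    using assms(3) by (fastforce simp: translate_tile_def)
  show ?thesis
    using hausdorff_dim_w_frontier_prototile[OF sub assms(2)] by (simp add: A frontier_translation)
qed

end
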